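(* $\mathrm{CE}_2=0$ if and only if, for $D_X$-almost every equivalence class $[x]$, $W_1([x])=0$. Here $\mathrm{CE}_2$ is the partition-based second-order calibration error of a higher-order predictor and $W_1([x])$ is the Wasserstein error of its associated 2-snapshot predictor on $[x]$, as defined in the context.
   Context: $X$ is a random input in $\mathcal X$ with law $D_X$, $f^*(x)=P(Y=1\mid X=x)$ for a label $Y\in\{0,1\}$. A partition $[\cdot]$ of $\mathcal X$ is fixed; $[x]$ denotes the element (equivalence class) containing $x$. A higher-order predictor $(m,\sigma^2)$, with $m\in[0,1]$, $\sigma^2\in[0,m(1-m)]$, is constant on partition elements, with values $m([x])$, $\sigma^2([x])$, and $v([x])=m([x])^2+\sigma^2([x])$. Put $\eta_j([x])=\mathbb E[f^*(X)^j\mid X\in[x]]$ for $j=1,2$, $\delta_1([x])=|\eta_1([x])-m([x])|$, $\delta_2([x])=|\eta_2([x])-v([x])|$, and $\mathrm{CE}_2=\mathbb E_{[x]\sim D_X}[\delta_1([x])+\delta_2([x])]$. A 2-snapshot is a pair $(y_1,y_2)\in\{0,1\}^2$ with $y_1,y_2$ i.i.d. $\mathrm{Bernoulli}(f^*(x))$ given $x$; it is identified with its empirical distribution on $\{0,1\}$, so the symmetrized snapshot space is $Y^{(2)}=\{0,\tfrac12,1\}$ (the atom is the fraction of ones), a subset of the set $\Delta Y$ of distributions on $\{0,1\}$. $\mathrm{proj}_2f^*([x])$ is the true distribution on $Y^{(2)}$ of symmetrized 2-snapshots drawn from $[x]$ (draw $X$ conditionally on $X\in[x]$, then two i.i.d.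 labels). The 2-snapshot predictor associated with $(m,\sigma^2)$ is $g(x)=(q_0,q_{1/2},q_1)\in\Delta Y^{(2)}$ with $q_1=v([x])$, $q_{1/2}=2(m([x])-v([x]))$, $q_0=1-2m([x])+v([x])$. Finally $W_1([x])=W_1\big(g(x),\mathrm{proj}_2f^*([x])\big)$ is the Wasserstein-1 distance with ground metric the $\ell_1$ distance on $\Delta Y$ (so $d(0,\tfrac12)=d(\tfrac12,1)=1$, $d(0,1)=2$). *)

theory Defs
  imports "HOL-Probability.Probability"
begin

section \<open>The label and its conditional probability\<close>

text \<open>\<open>f\<close> is a version of \<open>x \<mapsto> P(Y = 1 | X = x)\<close>, the label \<open>1\<close> being \<open>True\<close>.\<close>

definition is_label_prob ::
  "'w measure \<Rightarrow> 'a measure \<Rightarrow> ('w \<Rightarrow> 'a) \<Rightarrow> ('w \<Rightarrow> bool) \<Rightarrow> ('a \<Rightarrow> real) \<Rightarrow> bool" where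
  "is_label_prob \<Omega> S X Y f \<longleftrightarrow>
     f \<in> borel_measurable S \<and> (\<forall>x\<in>space S. 0 \<le> f x \<and> f x \<le> 1) \<and>
     (\<forall>A\<in>sets S. measure \<Omega> {w \<in> space \<Omega>. X w \<in> A \<and> Y w} = (LINT x:A|distr \<Omega> S X. f x))"

section \<open>Partitions and conditioning on a partition element\<close>

definition cls :: "'a set set \<Rightarrow> 'a \<Rightarrow> 'a set" where
  "cls P x = (THE c. c \<in> P \<and> x \<in> c)"

text \<open>
  \<open>\<kappa> c\<close> is the law of \<open>X\<close> given \<open>X \<in> c\<close>. Partition elements may be null sets (the partition may
  be uncountable), so the family of conditional laws is a disintegration of the law \<open>D\<close> of \<open>X\<close>:
  a probability kernel depending on \<open>x\<close> only through its class, almost surely concentrated on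
  that class, with average \<open>D\<close>. Lemma \<open>conditional_laws_positive\<close> below shows that it is the
  elementary conditional law on every class of positive mass.
\<close>

definition conditional_laws :: "'a measure \<Rightarrow> 'a set set \<Rightarrow> ('a set \<Rightarrow> 'a measure) \<Rightarrow> bool" where
  "conditional_laws D P \<kappa> \<longleftrightarrow>
     (\<lambda>x. \<kappa> (cls P x)) \<in> D \<rightarrow>\<^sub>M prob_algebra D \<and>
     (AE x in D. emeasure (\<kappa> (cls P x)) (cls P x) = 1) \<and>
     D \<bind> (\<lambda>x. \<kappa> (cls P x)) = D"

section \<open>Higher-order predictors and the second-order calibration error\<close>

text \<open>
  A predictor that is constant on partition elements is a pair of functions of the class;
  \<open>s c\<close> is the predicted variance.
\<close>

definition ho_predictor ::
  "'a measure \<Rightarrow> 'a set set \<Rightarrow> ('a set \<Rightarrow> real) \<Rightarrow> ('a set \<Rightarrow> real) \<Rightarrow> bool" where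
  "ho_predictor D P m s \<longleftrightarrow>
     (\<lambda>x. m (cls P x)) \<in> borel_measurable D \<and> (\<lambda>x. s (cls P x)) \<in> borel_measurable D \<and>
     (\<forall>c\<in>P. 0 \<le> m c \<and> m c \<le> 1 \<and> 0 \<le> s c \<and> s c \<le> m c * (1 - m c))"

definition second_moment :: "('a set \<Rightarrow> real) \<Rightarrow> ('a set \<Rightarrow> real) \<Rightarrow> 'a set \<Rightarrow> real" where
  "second_moment m s c = (m c)\<^sup>2 + s c"

definition true_moment :: "('a set \<Rightarrow> 'a measure) \<Rightarrow> ('a \<Rightarrow> real) \<Rightarrow> nat \<Rightarrow> 'a set \<Rightarrow> real" where
  "true_moment \<kappa> f j c = (LINT x|\<kappa> c. f x ^ j)"

definition \<delta>1 ::
  "('a set \<Rightarrow> 'a measure) \<Rightarrow> ('a \<Rightarrow> real) \<Rightarrow> ('a set \<Rightarrow> real) \<Rightarrow> 'a set \<Rightarrow> real" where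
  "\<delta>1 \<kappa> f m c = \<bar>true_moment \<kappa> f 1 c - m c\<bar>"

definition \<delta>2 ::
  "('a set \<Rightarrow> 'a measure) \<Rightarrow> ('a \<Rightarrow> real) \<Rightarrow> ('a set \<Rightarrow> real) \<Rightarrow> ('a set \<Rightarrow> real) \<Rightarrow> 'a set \<Rightarrow> real" where
  "\<delta>2 \<kappa> f m s c = \<bar>true_moment \<kappa> f 2 c - second_moment m s c\<bar>"

definition CE2 ::
  "'a measure \<Rightarrow> 'a set set \<Rightarrow> ('a set \<Rightarrow> 'a measure) \<Rightarrow> ('a \<Rightarrow> real) \<Rightarrow>
   ('a set \<Rightarrow> real) \<Rightarrow> ('a set \<Rightarrow> real) \<Rightarrow> real" where
  "CE2 D P \<kappa> f m s = (LINT x|D. \<delta>1 \<kappa> f m (cls P x) + \<delta>2 \<kappa> f m s (cls P x))"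

section \<open>Symmetrized 2-snapshots\<close>

text \<open>
  Distributions on \<open>{0,1}\<close> are of type \<^typ>\<open>bool pmf\<close>; the points \<open>0\<close>, \<open>1/2\<close>, \<open>1\<close> of the
  symmetrized snapshot space are the empirical distributions \<open>bernoulli_pmf 0\<close>,
  \<open>bernoulli_pmf (1/2)\<close>, \<open>bernoulli_pmf 1\<close> (lemma \<open>empirical2_eq_bernoulli\<close>).
\<close>

definition empirical2 :: "bool \<times> bool \<Rightarrow> bool pmf" where
  "empirical2 y = pmf_of_multiset {#fst y, snd y#}"

definition snapshot2 :: "real \<Rightarrow> bool pmf pmf" where
  "snapshot2 p = map_pmf empirical2 (pair_pmf (bernoulli_pmf p) (bernoulli_pmf p))"

definition proj2 :: "('a set \<Rightarrow> 'a measure) \<Rightarrow> ('a \<Rightarrow> real) \<Rightarrow> 'a set \<Rightarrow> bool pmf pmf" where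
  "proj2 \<kappa> f c = Abs_pmf (\<kappa> c \<bind> (\<lambda>x. measure_pmf (snapshot2 (f x))))"

definition snapshot_predictor2 ::
  "('a set \<Rightarrow> real) \<Rightarrow> ('a set \<Rightarrow> real) \<Rightarrow> 'a set \<Rightarrow> bool pmf pmf" where
  "snapshot_predictor2 m s c =
     (let v = second_moment m s c in
      pmf_of_list [(bernoulli_pmf 0, 1 - 2 * m c + v),
                   (bernoulli_pmf (1/2), 2 * (m c - v)),
                   (bernoulli_pmf 1, v)])"

section \<open>The Wasserstein distance\<close>

definition l1_dist :: "bool pmf \<Rightarrow> bool pmf \<Rightarrow> real" where
  "l1_dist p q = (\<Sum>b\<in>UNIV. \<bar>pmf p b - pmf q b\<bar>)"

definition couplings :: "'b pmf \<Rightarrow> 'b pmf \<Rightarrow> ('b \<times> 'b) pmf set" where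
  "couplings p q = {\<pi>. map_pmf fst \<pi> = p \<and> map_pmf snd \<pi> = q}"

text \<open>
  For a ground metric \<open>d\<close> that is bounded on the supports, so that all the expectations exist.
\<close>

definition wasserstein1 :: "('b \<Rightarrow> 'b \<Rightarrow> real) \<Rightarrow> 'b pmf \<Rightarrow> 'b pmf \<Rightarrow> real" where
  "wasserstein1 d p q =
     (INF \<pi>\<in>couplings p q. measure_pmf.expectation \<pi> (\<lambda>z. d (fst z) (snd z)))"

definition W1 ::
  "('a set \<Rightarrow> 'a measure) \<Rightarrow> ('a \<Rightarrow> real) \<Rightarrow> ('a set \<Rightarrow> real) \<Rightarrow> ('a set \<Rightarrow> real) \<Rightarrow> 'a set \<Rightarrow> real" where
  "W1 \<kappa> f m s c = wasserstein1 l1_dist (snapshot_predictor2 m s c) (proj2 \<kappa> f c)"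

section \<open>Adequacy of the definitions\<close>

lemma cls_eq: "partition_on A P \<Longrightarrow> c \<in> P \<Longrightarrow> x \<in> c \<Longrightarrow> cls P x = c"
  unfolding cls_def partition_on_def disjoint_def by (rule the_equality) auto

lemma cls_in:
  assumes "partition_on A P" "x \<in> A" shows "cls P x \<in> P" "x \<in> cls P x"
proof -
  obtain c where "c \<in> P" "x \<in> c" using assms by (auto simp: partition_on_def)
  then show "cls P x \<in> P" "x \<in> cls P x" using cls_eq[OF assms(1)] by auto
qed

lemma cls_eq_iff:
  assumes "partition_on A P" "c \<in> P" "x \<in> A" shows "cls P x = c \<longleftrightarrow> x \<in> c"
  using cls_eq[OF assms(1,2)] cls_in[OF assms(1,3)] by auto

lemma conditional_laws_positive:
  assumes D: "prob_space D" and P: "partition_on (space D) P" and \<kappa>: "conditional_laws D P \<kappa>"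
    and c: "c \<in> P" "c \<in> sets D" "emeasure D c \<noteq> 0"
  shows "\<kappa> c = uniform_measure D c"
proof (rule measure_eqI)
  interpret prob_space D by fact
  let ?k = "\<lambda>x. \<kappa> (cls P x)"
  have k: "?k \<in> D \<rightarrow>\<^sub>M prob_algebra D" and conc: "AE x in D. emeasure (?k x) (cls P x) = 1"
    and avg: "D \<bind> ?k = D" using \<kappa> by (auto simp: conditional_laws_def)
  have "c \<noteq> {}" using c by auto
  then obtain x0 where x0: "x0 \<in> c" "x0 \<in> space D" using c(1) P by (auto simp: partition_on_def)
  have sp: "\<kappa> (cls P x) \<in> space (prob_algebra D)" if "x \<in> space D" for x
    using measurable_space[OF k that] .
  have kc: "sets (\<kappa> c) = sets D" "prob_space (\<kappa> c)"
    using sp[OF x0(2)] cls_eq[OF P c(1) x0(1)] by (auto simp: space_prob_algebra)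
  then show "sets (\<kappa> c) = sets (uniform_measure D c)" by simp
  interpret kc: prob_space "\<kappa> c" by (rule kc)
  have conc_c: "emeasure (\<kappa> c) c = 1"
  proof (rule ccontr)
    assume n: "emeasure (\<kappa> c) c \<noteq> 1"
    have "AE x in D. x \<notin> c"
      using conc by eventually_elim (use n cls_eq[OF P c(1)] in auto)
    then have "emeasure D c = 0" using c(2) by (subst (asm) AE_iff_measurable[OF c(2)]) 
      (use sets.sets_into_space[OF c(2)] in auto)
    with c(3) show False by simp
  qed
  fix A assume "A \<in> sets (\<kappa> c)"
  then have A: "A \<in> sets D" using kc by simp
  have "emeasure D (A \<inter> c) = (\<integral>\<^sup>+x. emeasure (?k x) (A \<inter> c) \<partial>D)"
    by (subst avg[symmetric], rule emeasure_bind[where N=D])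
       (use A c k measurable_prob_algebraD[OF k] not_empty in auto)
  also have "\<dots> = (\<integral>\<^sup>+x. emeasure (\<kappa> c) (A \<inter> c) * indicator c x \<partial>D)"
  proof (rule nn_integral_cong_AE)
    show "AE x in D. emeasure (?k x) (A \<inter> c) = emeasure (\<kappa> c) (A \<inter> c) * indicator c x"
      using conc AE_space
    proof eventually_elim
      case (elim x)
      show ?case
      proof (cases "x \<in> c")
        case True then show ?thesis using cls_eq[OF P c(1)] by simp
      next
        case False
        let ?e = "cls P x"
        have e: "?e \<in> P" "?e \<noteq> c" using cls_in[OF P elim(2)] False by auto
        then have dis: "?e \<inter> c = {}" using P c(1) by (auto simp: partition_on_def disjoint_def)
        interpret ke: prob_space "?k x" using sp[OF elim(2)] by (simp add: space_prob_algebra)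
        have s: "sets (?k x) = sets D" using sp[OF elim(2)] by (simp add: space_prob_algebra)
        have eS: "?e \<in> sets (?k x)" using elim(1) emeasure_notin_sets[of ?e "?k x"] by force
        have "emeasure (?k x) (space (?k x) - ?e) = 0"
          using elim(1) eS by (subst emeasure_compl) (auto simp: ke.emeasure_space_1)
        moreover have "A \<inter> c \<subseteq> space (?k x) - ?e"
          using dis sets.sets_into_space[OF c(2)] sets_eq_imp_space_eq[OF s] by auto
        ultimately have "emeasure (?k x) (A \<inter> c) = 0"
          using eS by (metis emeasure_mono le_zero_eq sets.compl_sets)
        then show ?thesis using False by simp
      qed
    qed
  qed
  also have "\<dots> = emeasure (\<kappa> c) (A \<inter> c) * emeasure D c" using c by (simp add: nn_integral_cmult_indicator)
  also have "emeasure (\<kappa> c) (A \<inter> c) = emeasure (\<kappa> c) A"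
  proof (rule emeasure_eq_AE)
    have "AE x in \<kappa> c. x \<in> c"
      using conc_c c kc by (metis kc.AE_prob_1 kc.emeasure_eq_measure measure_def enn2real_1)
    then show "AE x in \<kappa> c. (x \<in> A \<inter> c) = (x \<in> A)" by eventually_elim auto
  qed (use A c kc in auto)
  finally have *: "emeasure D (A \<inter> c) = emeasure (\<kappa> c) A * emeasure D c" .
  show "emeasure (\<kappa> c) A = emeasure (uniform_measure D c) A"
    using A c * by (simp add: Int_commute mult_divide_eq_ennreal)
qed

lemma conditional_laws_exist:
  assumes D: "prob_space D" and P: "partition_on (space D) P"
    and cP: "countable P" and PS: "P \<subseteq> sets D"
  shows "\<exists>\<kappa>. conditional_laws D P \<kappa>"
proof -
  interpret prob_space D by fact
  define \<kappa> where "\<kappa> c = (if emeasure D c = 0 then return D (SOME x. x \<in> c) else uniform_measure D c)" for c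
  let ?k = "\<lambda>x. \<kappa> (cls P x)"
  have sel: "cls P \<in> D \<rightarrow>\<^sub>M count_space P"
    unfolding measurable_count_space_eq_countable[OF cP]
  proof (intro conjI ballI)
    show "cls P \<in> space D \<rightarrow> P" using cls_in[OF P] by auto
    fix c assume c: "c \<in> P"
    have "c \<subseteq> space D" using c P by (auto simp: partition_on_def)
    then have "cls P -` {c} \<inter> space D = c" using cls_eq_iff[OF P c] by blast
    then show "cls P -` {c} \<inter> space D \<in> sets D" using c PS by auto
  qed
  have pr: "\<kappa> c \<in> space (prob_algebra D)" if c: "c \<in> P" for c
  proof -
    have "(SOME x. x \<in> c) \<in> c" using P c by (auto simp: partition_on_def some_in_eq)
    then have "(SOME x. x \<in> c) \<in> space D" using c P by (auto simp: partition_on_def)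
    then show ?thesis
      by (auto simp: \<kappa>_def space_prob_algebra intro: prob_space_return prob_space_uniform_measure)
  qed
  have k: "?k \<in> D \<rightarrow>\<^sub>M prob_algebra D"
    by (rule measurable_compose[OF sel]) (use pr in auto)
  have conc: "emeasure (?k x) (cls P x) = 1" if "x \<in> space D" for x
  proof -
    have c: "cls P x \<in> P" "cls P x \<in> sets D" "cls P x \<noteq> {}" using cls_in[OF P that] PS by auto
    then show ?thesis
      by (auto simp: \<kappa>_def some_in_eq less_top[symmetric] intro!: ennreal_divide_self)
  qed
  have "D \<bind> ?k = D"
  proof (rule measure_eqI)
    show s: "sets (D \<bind> ?k) = sets D"
      by (rule sets_bind[where N=D]) (use measurable_space[OF k] not_empty in \<open>auto simp: space_prob_algebra\<close>)
    fix A assume "A \<in> sets (D \<bind> ?k)"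
    then have A: "A \<in> sets D" using s by simp
    have dj: "disjoint_family_on (\<lambda>c. A \<inter> c) P"
      using P unfolding partition_on_def disjoint_def disjoint_family_on_def by blast
    have "emeasure (D \<bind> ?k) A = (\<integral>\<^sup>+x. emeasure (?k x) A \<partial>D)"
      by (rule emeasure_bind[where N=D]) (use A measurable_prob_algebraD[OF k] not_empty in auto)
    also have "\<dots> = (\<integral>\<^sup>+x. (\<integral>\<^sup>+c. emeasure (\<kappa> c) A * indicator c x \<partial>count_space P) \<partial>D)"
    proof (rule nn_integral_cong)
      fix x assume x: "x \<in> space D"
      have "(\<integral>\<^sup>+c. emeasure (\<kappa> c) A * indicator c x \<partial>count_space P)
          = (\<integral>\<^sup>+c. emeasure (\<kappa> c) A * indicator {cls P x} c \<partial>count_space P)"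
        by (rule nn_integral_cong) (use cls_eq_iff[OF P _ x] in \<open>auto simp: indicator_def\<close>)
      then show "emeasure (?k x) A = (\<integral>\<^sup>+c. emeasure (\<kappa> c) A * indicator c x \<partial>count_space P)"
        using cls_in[OF P x] by (simp add: nn_integral_indicator_singleton)
    qed
    also have "\<dots> = (\<integral>\<^sup>+c. (\<integral>\<^sup>+x. emeasure (\<kappa> c) A * indicator c x \<partial>D) \<partial>count_space P)"
      by (rule nn_integral_count_space_nn_integral[OF cP])
         (use PS in auto)
    also have "\<dots> = (\<integral>\<^sup>+c. emeasure D (A \<inter> c) \<partial>count_space P)"
    proof (rule nn_integral_cong)
      fix c assume "c \<in> space (count_space P)"
      then have c: "c \<in> sets D" using PS by auto
      have z: "emeasure D (A \<inter> c) = 0" if "emeasure D c = 0"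
        using that c by (metis emeasure_mono inf_le2 le_zero_eq)
      have "emeasure (\<kappa> c) A * emeasure D c = emeasure D (A \<inter> c)"
        using c A z by (auto simp: \<kappa>_def Int_commute
            ennreal_divide_times ennreal_divide_self less_top[symmetric])
      then show "(\<integral>\<^sup>+x. emeasure (\<kappa> c) A * indicator c x \<partial>D) = emeasure D (A \<inter> c)"
        using c by (simp add: nn_integral_cmult_indicator)
    qed
    also have "\<dots> = emeasure D (\<Union>c\<in>P. A \<inter> c)"
      using A PS cP dj by (intro emeasure_UN_countable[symmetric]) auto
    also have "(\<Union>c\<in>P. A \<inter> c) = A"
      using A sets.sets_into_space[OF A] P by (auto simp: partition_on_def)
    finally show "emeasure (D \<bind> ?k) A = emeasure D A" .
  qed
  with k conc show ?thesis by (auto simp: conditional_laws_def intro!: exI[of _ \<kappa>])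
qed

lemma empirical2_eq_bernoulli:
  "empirical2 (y1, y2) = bernoulli_pmf ((of_bool y1 + of_bool y2) / 2)"
  by (rule pmf_eqI; case_tac i; cases y1; cases y2)
     (simp_all add: empirical2_def pmf_of_multiset)

lemma l1_dist_bernoulli:
  assumes "0 \<le> p" "p \<le> 1" "0 \<le> q" "q \<le> 1"
  shows "l1_dist (bernoulli_pmf p) (bernoulli_pmf q) = 2 * \<bar>p - q\<bar>"
  using assms by (auto simp: l1_dist_def UNIV_bool)

lemma pmf_snapshot2:
  assumes "0 \<le> p" "p \<le> 1"
  shows "pmf (snapshot2 p) r =
    (if r = bernoulli_pmf 0 then (1 - p)\<^sup>2 else if r = bernoulli_pmf (1/2) then 2 * p * (1 - p)
     else if r = bernoulli_pmf 1 then p\<^sup>2 else 0)"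
proof -
  have ne: "bernoulli_pmf a \<noteq> bernoulli_pmf b" if "a \<noteq> b" "a \<in> {0, 1/2, 1}" "b \<in> {0, 1/2, 1}" for a b
  proof
    assume "bernoulli_pmf a = bernoulli_pmf b"
    then have "pmf (bernoulli_pmf a) True = pmf (bernoulli_pmf b) True" by simp
    with that show False by auto
  qed
  have "pmf (snapshot2 p) r = measure (pair_pmf (bernoulli_pmf p) (bernoulli_pmf p)) (empirical2 -` {r})"
    by (simp add: snapshot2_def pmf_map)
  also have "\<dots> = (\<Sum>y\<in>UNIV. if empirical2 y = r
      then pmf (bernoulli_pmf p) (fst y) * pmf (bernoulli_pmf p) (snd y) else 0)"
    by (subst measure_measure_pmf_finite)
       (auto simp: sum.If_cases vimage_def pmf_pair intro!: sum.cong finite_subset[OF subset_UNIV])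
  also have "\<dots> = (\<Sum>a\<in>UNIV. \<Sum>b\<in>UNIV. if empirical2 (a, b) = r
      then pmf (bernoulli_pmf p) a * pmf (bernoulli_pmf p) b else 0)"
    by (simp add: sum.cartesian_product UNIV_Times_UNIV[symmetric] split_beta del: UNIV_Times_UNIV)
  finally show ?thesis
    using assms ne[of 0 "1/2"] ne[of 0 1] ne[of "1/2" 1]
    by (auto simp: UNIV_bool empirical2_eq_bernoulli power2_eq_square)
qed

lemma pmf_proj2:
  assumes f: "f \<in> borel_measurable S" "\<And>x. x \<in> space S \<Longrightarrow> 0 \<le> f x \<and> f x \<le> 1"
    and \<kappa>: "prob_space (\<kappa> c)" "sets (\<kappa> c) = sets S"
  shows "pmf (proj2 \<kappa> f c) r = (LINT x|\<kappa> c. pmf (snapshot2 (f x)) r)"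
proof -
  interpret prob_space "\<kappa> c" by fact
  let ?N = "\<kappa> c \<bind> (\<lambda>x. measure_pmf (snapshot2 (f x)))"
  let ?E = "{bernoulli_pmf 0, bernoulli_pmf (1/2), bernoulli_pmf 1}"
  have [measurable_cong]: "sets (\<kappa> c) = sets S" by fact
  have sp: "space (\<kappa> c) = space S" using sets_eq_imp_space_eq[OF \<kappa>(2)] .
  note [measurable] = f(1)
  have supp: "measure (measure_pmf (snapshot2 p)) B = (\<Sum>r\<in>?E. pmf (snapshot2 p) r * indicator B r)"
    if "0 \<le> p" "p \<le> 1" for p B
  proof -
    have "set_pmf (snapshot2 p) \<subseteq> ?E"
      using that by (auto simp: set_pmf_eq pmf_snapshot2 split: if_splits)
    then have "measure (measure_pmf (snapshot2 p)) B = measure (measure_pmf (snapshot2 p)) (B \<inter> ?E)"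
      by (intro measure_eq_AE) (auto simp: AE_measure_pmf_iff)
    then show ?thesis
      by (simp add: measure_measure_pmf_finite indicator_def if_distrib sum.If_cases Int_commute
          flip: sum.inter_restrict cong: if_cong)
  qed
  have K: "(\<lambda>x. measure_pmf (snapshot2 (f x))) \<in> \<kappa> c \<rightarrow>\<^sub>M subprob_algebra (count_space UNIV)"
  proof (rule measurable_subprob_algebra)
    show "subprob_space (measure_pmf (snapshot2 (f x)))" for x by (rule measure_pmf.subprob_space_axioms)
    fix B :: "bool pmf set"
    have "(\<lambda>x. ennreal (\<Sum>r\<in>?E. (if r = bernoulli_pmf 0 then (1 - f x)\<^sup>2
          else if r = bernoulli_pmf (1/2) then 2 * f x * (1 - f x)
          else if r = bernoulli_pmf 1 then (f x)\<^sup>2 else 0) * indicator B r)) \<in> borel_measurable (\<kappa> c)"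
      by measurable
    then show "(\<lambda>x. emeasure (measure_pmf (snapshot2 (f x))) B) \<in> borel_measurable (\<kappa> c)"
      by (rule measurable_cong[THEN iffD1, rotated])
         (use f(2) sp in \<open>simp add: measure_pmf.emeasure_eq_measure supp pmf_snapshot2\<close>)
  qed simp
  have sets_N: "sets ?N = UNIV"
    using sets_bind[OF _ not_empty, of "\<lambda>x. measure_pmf (snapshot2 (f x))" "count_space UNIV"] by simp
  interpret N: prob_space ?N
    by (rule prob_space_bind[OF _ K]) (simp add: measure_pmf.prob_space_axioms)
  have N_eq: "measure ?N B = (LINT x|\<kappa> c. measure (measure_pmf (snapshot2 (f x))) B)" for B
    by (rule measure_bind[OF K]) simp
  have "measure ?N ?E = (LINT x|\<kappa> c. 1)"
    unfolding N_eq
  proof (rule Bochner_Integration.integral_cong[OF refl])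
    fix x assume "x \<in> space (\<kappa> c)"
    then have "0 \<le> f x" "f x \<le> 1" using f(2) sp by auto
    then have "set_pmf (snapshot2 (f x)) \<subseteq> ?E"
      by (auto simp: set_pmf_eq pmf_snapshot2 split: if_splits)
    then show "measure (measure_pmf (snapshot2 (f x))) ?E = 1"
      by (simp add: measure_pmf.prob_eq_1 AE_measure_pmf_iff subset_iff)
  qed
  then have "measure ?N ?E = 1" by (simp add: prob_space)
  then have AE_E: "AE r in ?N. r \<in> ?E"
    using N.prob_eq_1[of ?E] sets_N by simp
  have "AE r in ?N. measure ?N {r} \<noteq> 0"
  proof -
    let ?Z = "{r \<in> ?E. measure ?N {r} = 0}"
    have "measure ?N ?Z = (\<Sum>r\<in>?Z. measure ?N {r})"
      by (rule N.finite_measure_eq_sum_singleton) (auto simp: sets_N)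
    also have "\<dots> = 0" by (rule sum.neutral) blast
    finally have "AE r in ?N. r \<notin> ?Z" using N.prob_eq_0[of ?Z] sets_N by simp
    with AE_E show ?thesis by eventually_elim blast
  qed
  then have "measure_pmf (proj2 \<kappa> f c) = ?N"
    unfolding proj2_def using N.prob_space_axioms sets_N by (intro Abs_pmf_inverse) simp
  then show ?thesis by (simp add: pmf.rep_eq N_eq)
qed

end

(* On every class W_1 vanishes exactly when the two distributions on the three-point snapshot space
   agree, and these are parametrized injectively by their first two moments: q_1 = v and
   q_{1/2} = 2(m - v). Hence W_1([x]) = 0 iff delta_1([x]) + delta_2([x]) = 0, and the integral CE_2
   of this bounded non-negative function is zero iff the function is zero almost everywhere. *)
theory Submission
  imports Defs
begin

text \<open>Under any coupling the mass difference at \<open>r\<close> is the expectation of a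
  difference of two indicators. That difference is at most 1 in absolute value and vanishes on the
  diagonal, while off the diagonal the cost is at least \<open>\<epsilon>\<close>. The bound is
  uniform in the coupling, so it passes to the infimum without an optimal coupling.\<close>

lemma wasserstein1_ge_pmf_diff:
  fixes d :: "'b \<Rightarrow> 'b \<Rightarrow> real"
  assumes fin: "finite (set_pmf p)" "finite (set_pmf q)" and nonneg: "\<And>x y. 0 \<le> d x y"
    and sep: "\<And>x y. x \<in> set_pmf p \<Longrightarrow> y \<in> set_pmf q \<Longrightarrow> x \<noteq> y \<Longrightarrow> \<epsilon> \<le> d x y" and "0 \<le> \<epsilon>"
  shows "\<epsilon> * \<bar>pmf p r - pmf q r\<bar> \<le> wasserstein1 d p q"
  unfolding wasserstein1_def
proof (rule cINF_greatest)
  have "pair_pmf p q \<in> couplings p q"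
    by (simp add: couplings_def map_fst_pair_pmf map_snd_pair_pmf)
  then show "couplings p q \<noteq> {}" by blast
next
  fix \<pi> assume "\<pi> \<in> couplings p q"
  then have p: "p = map_pmf fst \<pi>" and q: "q = map_pmf snd \<pi>" by (auto simp: couplings_def)
  \<comment> \<open>Finite support makes every cost integrable, and the inclusion lets
    \<open>sep\<close> apply to every pair that the coupling charges.\<close>
  have supp: "set_pmf \<pi> \<subseteq> set_pmf p \<times> set_pmf q" by (force simp: p q)
  then have "finite (set_pmf \<pi>)" using fin by (meson finite_SigmaI finite_subset)
  then have int: "integrable (measure_pmf \<pi>) h" for h :: "_ \<Rightarrow> real"
    by (rule integrable_measure_pmf_finite)
  have pr: "pmf p r = measure_pmf.expectation \<pi> (\<lambda>z. indicator {r} (fst z))"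
    and qr: "pmf q r = measure_pmf.expectation \<pi> (\<lambda>z. indicator {r} (snd z))"
    by (simp_all add: p q pmf_map measure_pmf.prob_space flip: indicator_vimage)
  have "\<epsilon> * \<bar>pmf p r - pmf q r\<bar>
      = \<epsilon> * \<bar>measure_pmf.expectation \<pi> (\<lambda>z. indicator {r} (fst z) - indicator {r} (snd z))\<bar>"
    unfolding pr qr using int by (subst Bochner_Integration.integral_diff) auto
  also have "\<dots> \<le> \<epsilon> * measure_pmf.expectation \<pi>
      (\<lambda>z. \<bar>indicator {r} (fst z) - indicator {r} (snd z)\<bar>)"
    by (intro mult_left_mono integral_abs_bound \<open>0 \<le> \<epsilon>\<close>)
  also have "\<dots> = measure_pmf.expectation \<pi>
      (\<lambda>z. \<epsilon> * \<bar>indicator {r} (fst z) - indicator {r} (snd z)\<bar>)"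
    by simp
  also have "\<dots> \<le> measure_pmf.expectation \<pi> (\<lambda>z. d (fst z) (snd z))"
  proof (rule integral_mono_AE[OF int int])
    show "AE z in measure_pmf \<pi>. \<epsilon> * \<bar>indicator {r} (fst z) - indicator {r} (snd z)\<bar>
        \<le> d (fst z) (snd z)"
      using supp sep nonneg by (fastforce simp: AE_measure_pmf_iff indicator_def)
  qed
  finally show "\<epsilon> * \<bar>pmf p r - pmf q r\<bar>
      \<le> measure_pmf.expectation \<pi> (\<lambda>z. d (fst z) (snd z))" .
qed

text \<open>The diagonal coupling costs nothing, and no coupling has negative cost.\<close>

lemma wasserstein1_self:
  fixes d :: "'b \<Rightarrow> 'b \<Rightarrow> real"
  assumes nonneg: "\<And>x y. 0 \<le> d x y" and refl: "\<And>x. d x x = 0"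
  shows "wasserstein1 d p p = 0"
proof (rule antisym)
  have diag: "map_pmf (\<lambda>x. (x, x)) p \<in> couplings p p"
    by (simp add: couplings_def pmf.map_comp o_def)
  show "wasserstein1 d p p \<le> 0"
    unfolding wasserstein1_def
    by (rule cINF_lower2[OF bdd_belowI[of _ 0] diag]) (auto simp: refl nonneg integral_nonneg_AE)
  show "0 \<le> wasserstein1 d p p"
    unfolding wasserstein1_def
    by (rule cINF_greatest) (use diag nonneg in \<open>auto intro: integral_nonneg_AE\<close>)
qed

text \<open>Finitely many pairs of distinct support points have a common positive lower bound on
  their distances; with this separation, distance zero forces equal masses at every point.\<close>

lemma wasserstein1_eq_0_iff:
  fixes d :: "'b \<Rightarrow> 'b \<Rightarrow> real"
  assumes fin: "finite (set_pmf p)" "finite (set_pmf q)" and nonneg: "\<And>x y. 0 \<le> d x y"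
    and zero: "\<And>x y. d x y = 0 \<longleftrightarrow> x = y"
  shows "wasserstein1 d p q = 0 \<longleftrightarrow> p = q"
proof
  assume W: "wasserstein1 d p q = 0"
  \<comment> \<open>Inserting 1 keeps \<open>A\<close> nonempty when the supports contain no pair of
    distinct points, so \<open>Min A\<close> is always a positive separation.\<close>
  define A where "A = insert 1 ((\<lambda>(x, y). d x y) ` {z \<in> set_pmf p \<times> set_pmf q. fst z \<noteq> snd z})"
  have A: "finite A" "A \<noteq> {}" using fin by (auto simp: A_def)
  have pos: "0 < Min A"
  proof -
    have "0 < a" if "a \<in> A" for a
      using that nonneg zero by (fastforce simp: A_def less_le)
    then show ?thesis using A by simp
  qed
  have sep: "Min A \<le> d x y" if "x \<in> set_pmf p" "y \<in> set_pmf q" "x \<noteq> y" for x y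
    by (rule Min_le[OF A(1)]) (use that in \<open>force simp: A_def\<close>)
  show "p = q"
  proof (rule pmf_eqI)
    fix r
    have "Min A * \<bar>pmf p r - pmf q r\<bar> \<le> 0"
      using wasserstein1_ge_pmf_diff[where d = d and r = r, OF fin nonneg sep] W pos by simp
    then show "pmf p r = pmf q r" using pos by (simp add: mult_le_0_iff)
  qed
next
  assume "p = q"
  then show "wasserstein1 d p q = 0" using wasserstein1_self[of d q] nonneg zero by simp
qed

lemma l1_dist_nonneg: "0 \<le> l1_dist p q"
  by (simp add: l1_dist_def sum_nonneg)

lemma l1_dist_eq_0_iff: "l1_dist p q = 0 \<longleftrightarrow> p = q"
  by (auto simp: l1_dist_def sum_nonneg_eq_0_iff intro: pmf_eqI)

text \<open>The mass at \<open>True\<close> recovers the parameter; the bounds matter because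
  \<open>bernoulli_pmf\<close> clamps its argument to the unit interval. This keeps the three
  snapshot atoms apart.\<close>

lemma bernoulli_pmf_eq_iff:
  assumes "0 \<le> p" "p \<le> 1" "0 \<le> q" "q \<le> 1"
  shows "bernoulli_pmf p = bernoulli_pmf q \<longleftrightarrow> p = q"
  using assms pmf_bernoulli_True by metis

text \<open>These are the signs of the three predicted snapshot weights: the middle one is the
  variance bound rewritten as \<open>v \<le> m\<close>, the last is
  \<open>(1 - m)\<^sup>2 + s\<close>.\<close>

lemma second_moment_bounds:
  assumes "0 \<le> m c" "0 \<le> s c" "s c \<le> m c * (1 - m c)"
  shows "0 \<le> second_moment m s c" "second_moment m s c \<le> m c"
    "0 \<le> 1 - 2 * m c + second_moment m s c"
proof -
  show "0 \<le> second_moment m s c" "second_moment m s c \<le> m c"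
    using assms by (auto simp: second_moment_def power2_eq_square algebra_simps)
  have "1 - 2 * m c + second_moment m s c = (1 - m c)\<^sup>2 + s c"
    by (simp add: second_moment_def power2_eq_square algebra_simps)
  then show "0 \<le> 1 - 2 * m c + second_moment m s c" using assms by simp
qed

lemma pmf_snapshot_predictor2:
  assumes "0 \<le> m c" "0 \<le> s c" "s c \<le> m c * (1 - m c)"
  shows "pmf (snapshot_predictor2 m s c) r =
    (if r = bernoulli_pmf 0 then 1 - 2 * m c + second_moment m s c
     else if r = bernoulli_pmf (1/2) then 2 * (m c - second_moment m s c)
     else if r = bernoulli_pmf 1 then second_moment m s c else 0)"
proof -
  let ?v = "second_moment m s c"
  \<comment> \<open>\<open>pmf_of_list\<close> has the listed masses only if the weights are
    nonnegative and sum to one; the sum is one identically in \<open>m\<close> and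
    \<open>v\<close>.\<close>
  have wf: "pmf_of_list_wf [(bernoulli_pmf 0, 1 - 2 * m c + ?v),
      (bernoulli_pmf (1/2), 2 * (m c - ?v)), (bernoulli_pmf 1, ?v)]"
    using second_moment_bounds[where m = m and c = c and s = s, OF assms] by (auto simp: pmf_of_list_wf_def)
  show ?thesis
    unfolding snapshot_predictor2_def Let_def pmf_pmf_of_list[OF wf]
    by (auto simp: bernoulli_pmf_eq_iff)
qed

context
  fixes S :: "'a measure" and \<kappa> :: "'a set \<Rightarrow> 'a measure" and c :: "'a set" and f :: "'a \<Rightarrow> real"
  assumes f: "f \<in> borel_measurable S" "\<And>x. x \<in> space S \<Longrightarrow> 0 \<le> f x \<and> f x \<le> 1"
    and \<kappa>: "prob_space (\<kappa> c)" "sets (\<kappa> c) = sets S"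
begin

lemma unit_interval_on_law: "x \<in> space (\<kappa> c) \<Longrightarrow> 0 \<le> f x \<and> f x \<le> 1"
  using f(2) sets_eq_imp_space_eq[OF \<kappa>(2)] by auto

lemma integrable_power_law: "integrable (\<kappa> c) (\<lambda>x. f x ^ j)"
proof -
  interpret prob_space "\<kappa> c" by fact
  have [measurable]: "f \<in> borel_measurable (\<kappa> c)" using f(1) \<kappa>(2) measurable_cong_sets by blast
  show ?thesis
    by (rule integrable_const_bound[of _ 1])
       (use unit_interval_on_law in \<open>auto simp: power_le_one\<close>)
qed

lemma true_moment_bounds: "0 \<le> true_moment \<kappa> f j c" "true_moment \<kappa> f j c \<le> 1"
proof -
  interpret prob_space "\<kappa> c" by fact
  show "0 \<le> true_moment \<kappa> f j c"
    unfolding true_moment_def using unit_interval_on_law by (intro integral_nonneg_AE) auto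
  show "true_moment \<kappa> f j c \<le> 1"
    unfolding true_moment_def using unit_interval_on_law
    by (intro integral_le_const integrable_power_law) (auto simp: power_le_one)
qed

text \<open>Given the success probability \<open>p\<close>, each atom has mass
  \<open>(1 - p)\<^sup>2\<close>, \<open>2 * p * (1 - p)\<close> or \<open>p\<^sup>2\<close>. These
  are quadratic in \<open>p\<close>, so averaging over the class sees only the first two moments.
  The result is the predictor's formula with the true moments in place of \<open>m\<close> and
  \<open>v\<close>.\<close>

lemma pmf_proj2_moments:
  "pmf (proj2 \<kappa> f c) r =
    (if r = bernoulli_pmf 0 then 1 - 2 * true_moment \<kappa> f 1 c + true_moment \<kappa> f 2 c
     else if r = bernoulli_pmf (1/2) then 2 * (true_moment \<kappa> f 1 c - true_moment \<kappa> f 2 c)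
     else if r = bernoulli_pmf 1 then true_moment \<kappa> f 2 c else 0)"
proof -
  interpret prob_space "\<kappa> c" by fact
  \<comment> \<open>Coefficients of \<open>1\<close>, \<open>f x\<close> and
    \<open>(f x)\<^sup>2\<close> in the mass of \<open>r\<close>, so that linearity of the integral
    handles all atoms at once.\<close>
  let ?a = "if r = bernoulli_pmf 0 then 1 else 0 :: real"
  let ?b = "if r = bernoulli_pmf 0 then -2 else if r = bernoulli_pmf (1/2) then 2 else 0 :: real"
  let ?e = "if r = bernoulli_pmf 0 then 1 else if r = bernoulli_pmf (1/2) then -2
    else if r = bernoulli_pmf 1 then 1 else 0 :: real"
  note int = integrable_power_law[of 1, unfolded power_one_right] integrable_power_law[of 2]
  have "pmf (proj2 \<kappa> f c) r = (LINT x|\<kappa> c. pmf (snapshot2 (f x)) r)"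
    by (rule pmf_proj2[where c = c and \<kappa> = \<kappa>, OF f \<kappa>])
  also have "\<dots> = (LINT x|\<kappa> c. ?a + ?b * f x + ?e * (f x)\<^sup>2)"
    by (rule Bochner_Integration.integral_cong[OF refl])
       (use unit_interval_on_law in \<open>auto simp: pmf_snapshot2 power2_eq_square algebra_simps\<close>)
  also have "\<dots> = ?a + ?b * (LINT x|\<kappa> c. f x) + ?e * (LINT x|\<kappa> c. (f x)\<^sup>2)"
    using int by (simp add: prob_space del: mult_cancel_left)
  finally show ?thesis by (auto simp: true_moment_def)
qed

lemma W1_eq_0_iff:
  assumes ms: "0 \<le> m c" "0 \<le> s c" "s c \<le> m c * (1 - m c)"
  shows "W1 \<kappa> f m s c = 0 \<longleftrightarrow> \<delta>1 \<kappa> f m c + \<delta>2 \<kappa> f m s c = 0"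
proof -
  let ?E = "{bernoulli_pmf 0, bernoulli_pmf (1/2), bernoulli_pmf 1}"
  let ?g = "snapshot_predictor2 m s c" and ?q = "proj2 \<kappa> f c"
  note pmfs = pmf_snapshot_predictor2[where m = m and c = c and s = s, OF ms] pmf_proj2_moments
  have "set_pmf ?g \<subseteq> ?E" "set_pmf ?q \<subseteq> ?E"
    by (auto simp: set_pmf_eq pmfs split: if_splits)
  then have "finite (set_pmf ?g)" "finite (set_pmf ?q)" by (auto intro: finite_subset)
  then have "W1 \<kappa> f m s c = 0 \<longleftrightarrow> ?g = ?q"
    unfolding W1_def by (rule wasserstein1_eq_0_iff[OF _ _ l1_dist_nonneg l1_dist_eq_0_iff])
  also have "\<dots> \<longleftrightarrow> true_moment \<kappa> f 1 c = m c \<and> true_moment \<kappa> f 2 c = second_moment m s c"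
  proof
    assume "?g = ?q"
    \<comment> \<open>The atom \<open>1\<close> carries the second moment; the atom
      \<open>1/2\<close> carries twice the difference of the moments and then determines the
      first.\<close>
    then have "pmf ?g (bernoulli_pmf 1) = pmf ?q (bernoulli_pmf 1)"
      and "pmf ?g (bernoulli_pmf (1/2)) = pmf ?q (bernoulli_pmf (1/2))" by simp_all
    then show "true_moment \<kappa> f 1 c = m c \<and> true_moment \<kappa> f 2 c = second_moment m s c"
      by (simp add: pmfs bernoulli_pmf_eq_iff)
  qed (auto intro!: pmf_eqI simp: pmfs)
  also have "\<dots> \<longleftrightarrow> \<delta>1 \<kappa> f m c + \<delta>2 \<kappa> f m s c = 0"
    by (auto simp: \<delta>1_def \<delta>2_def)
  finally show ?thesis .
qed

text \<open>True and predicted moments all lie in the unit interval, so each deviation is at most 1.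
  The bound serves to make the integrand of \<open>CE2\<close> integrable.\<close>

lemma calibration_error_le_2:
  assumes ms: "0 \<le> m c" "m c \<le> 1" "0 \<le> s c" "s c \<le> m c * (1 - m c)"
  shows "\<delta>1 \<kappa> f m c + \<delta>2 \<kappa> f m s c \<le> 2"
  using true_moment_bounds[of 1] true_moment_bounds[of 2] second_moment_bounds[where m = m and c = c and s = s, OF ms(1,3,4)] ms(1,2)
  unfolding \<delta>1_def \<delta>2_def by linarith

end

text \<open>Integrating a fixed measurable function is measurable in the measure; this map is
  composed with the kernel.\<close>

lemma borel_measurable_true_moment:
  assumes "f \<in> borel_measurable D" and "(\<lambda>x. \<kappa> (k x)) \<in> D \<rightarrow>\<^sub>M prob_algebra D"
  shows "(\<lambda>x. true_moment \<kappa> f j (k x)) \<in> borel_measurable D"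
proof -
  have "(\<lambda>M. LINT y|M. f y ^ j) \<in> borel_measurable (subprob_algebra D)"
    using assms(1) by (intro integral_measurable_subprob_algebra) simp
  from measurable_compose[OF measurable_prob_algebraD[OF assms(2)] this]
  show ?thesis by (simp add: true_moment_def)
qed

theorem mainTheorem9:
  fixes \<Omega> :: "'w measure" and S D\<^sub>X :: "'a measure"
    and X :: "'w \<Rightarrow> 'a" and Y :: "'w \<Rightarrow> bool" and fstar :: "'a \<Rightarrow> real"
    and P :: "'a set set" and \<kappa> :: "'a set \<Rightarrow> 'a measure"
    and m s :: "'a set \<Rightarrow> real"
  assumes "prob_space \<Omega>" and "X \<in> \<Omega> \<rightarrow>\<^sub>M S" and "Y \<in> \<Omega> \<rightarrow>\<^sub>M count_space UNIV"
    and "D\<^sub>X = distr \<Omega> S X"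
    and "is_label_prob \<Omega> S X Y fstar"
    and "partition_on (space S) P" and "P \<subseteq> sets S"
    and "conditional_laws D\<^sub>X P \<kappa>"
    and "ho_predictor D\<^sub>X P m s"
  shows "CE2 D\<^sub>X P \<kappa> fstar m s = 0 \<longleftrightarrow> (AE x in D\<^sub>X. W1 \<kappa> fstar m s (cls P x) = 0)"
proof -
  interpret D: prob_space D\<^sub>X
    unfolding assms(4) by (rule prob_space.prob_space_distr) fact+
  have DS: "sets D\<^sub>X = sets S" "space D\<^sub>X = space S" by (simp_all add: assms(4))
  have f: "fstar \<in> borel_measurable S" "\<And>x. x \<in> space S \<Longrightarrow> 0 \<le> fstar x \<and> fstar x \<le> 1"
    using assms(5) by (auto simp: is_label_prob_def)
  have fD: "fstar \<in> borel_measurable D\<^sub>X" using f(1) DS(1) measurable_cong_sets by blast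
  have k: "(\<lambda>x. \<kappa> (cls P x)) \<in> D\<^sub>X \<rightarrow>\<^sub>M prob_algebra D\<^sub>X"
    using assms(8) by (simp add: conditional_laws_def)
  \<comment> \<open>Measurability into \<open>prob_algebra\<close> gives a probability law at every
    point, so the results for a single class apply to each \<open>cls P x\<close>.\<close>
  have \<kappa>: "prob_space (\<kappa> (cls P x))" "sets (\<kappa> (cls P x)) = sets S" if "x \<in> space D\<^sub>X" for x
    using measurable_space[OF k that] DS by (auto simp: space_prob_algebra)
  have ms: "0 \<le> m (cls P x)" "m (cls P x) \<le> 1" "0 \<le> s (cls P x)"
    "s (cls P x) \<le> m (cls P x) * (1 - m (cls P x))" if "x \<in> space D\<^sub>X" for x
    using assms(9) cls_in(1)[OF assms(6)] that DS by (auto simp: ho_predictor_def)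
  let ?h = "\<lambda>x. \<delta>1 \<kappa> fstar m (cls P x) + \<delta>2 \<kappa> fstar m s (cls P x)"
  have nonneg: "0 \<le> ?h x" for x by (simp add: \<delta>1_def \<delta>2_def)
  have [measurable]: "(\<lambda>x. m (cls P x)) \<in> borel_measurable D\<^sub>X"
    "(\<lambda>x. s (cls P x)) \<in> borel_measurable D\<^sub>X"
    using assms(9) by (simp_all add: ho_predictor_def)
  note [measurable] = borel_measurable_true_moment[where k = "cls P", OF fD k]
  have meas: "?h \<in> borel_measurable D\<^sub>X"
    unfolding \<delta>1_def \<delta>2_def second_moment_def by measurable
  \<comment> \<open>Integrability is essential: the Bochner integral of a non-integrable function is
    0 by convention, and \<open>CE2 = 0\<close> would then say nothing about the integrand.\<close>
  have "integrable D\<^sub>X ?h"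
    by (rule D.integrable_const_bound[OF _ meas, of 2])
       (use nonneg calibration_error_le_2[where c = "cls P _" and \<kappa> = \<kappa> and m = m and s = s, OF f \<kappa> ms] in auto)
  then have "CE2 D\<^sub>X P \<kappa> fstar m s = 0 \<longleftrightarrow> (AE x in D\<^sub>X. ?h x = 0)"
    unfolding CE2_def by (rule integral_nonneg_eq_0_iff_AE) (use nonneg in auto)
  also have "\<dots> \<longleftrightarrow> (AE x in D\<^sub>X. W1 \<kappa> fstar m s (cls P x) = 0)"
    by (rule AE_cong) (use W1_eq_0_iff[where c = "cls P _" and \<kappa> = \<kappa> and m = m and s = s, OF f \<kappa> ms(1,3,4)] in blast)
  finally show ?thesis .
qed

end
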